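(* Class tables of non-expansive type systems describe exactly the regular forests: $\mathcal{L}(\mathcal{T}_{\{M\}})=\mathcal{L}(\mathcal{T}_{\{C,M\}})=\mathrm{NRF}$.
   Context: Terms. A ranked alphabet is a finite set of symbols, each with a rank in $\mathbb{N}$; $A^{\triangle}$ is the set of finite ground terms (trees) over a ranked alphabet $A$. $X$ is a set of parameters (rank $0$), disjoint from other alphabets; $\tau[\boldsymbol{x}\leftarrow\boldsymbol{t}]$ is simultaneous substitution. Class tables. A class table $\Delta$ over a finite set of class names $\Gamma$ consists of one declaration $\gamma(\diamond_1x_1,\dots,\diamond_kx_k):\tau_1,\dots,\tau_m$ ($k,m\ge 0$) for each $\gamma\in\Gamma$, where $k$ is the rank of $\gamma$, the $x_i\in X$ are distinct, $\diamond_i\in\{\circ,+,-\}$ (invariant, covariant, contravariant) is the variance of the $i$-th parameter of $\gamma$, denoted $\mathrm{var}_i(\gamma)$, and the supertypes $\tau_j$ are terms over $\Gamma\cup\{x_1,\dots,x_k\}$, none of which is itself a parameter. Ground types are elements of $\Gamma^{\triangle}$. We write $\gamma(\boldsymbol{x}):\tau$ if $\tau$ is one of the declared supertypes of $\gamma$. Inheritance. $\gamma(\boldsymbol{t})\rightarrowtail\tau[\boldsymbol{x}\leftarrow\boldsymbol{t}]$ whenever $\gamma(\boldsymbol{x}):\tau$. Class inheritance closure $:^*$ is the least relation with $\gamma(\boldsymbol{x}):^*\gamma(\boldsymbol{x})$, and $\gamma(\boldsymbol{x}):^*\tau[\boldsymbol{x}'\leftarrow\boldsymbol{\tau}]$ whenever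 $\gamma(\boldsymbol{x}):\gamma'(\boldsymbol{\tau})$ and $\gamma'(\boldsymbol{x}'):^*\tau$; $:^+$ and $\rightarrowtail^+$ are the transitive, non-reflexive versions (one or more steps). Subtyping. $<:$ is the least relation on ground types closed under: (Var) $\gamma(t_1,\dots,t_k)<:\gamma(t_1',\dots,t_k')$ if for every $i$: $t_i<:t_i'$ when $\mathrm{var}_i(\gamma)=+$, $t_i=t_i'$ when $\mathrm{var}_i(\gamma)=\circ$, and $t_i'<:t_i$ when $\mathrm{var}_i(\gamma)=-$; (Super) $t<:t''$ if $t\rightarrowtail t'$ and $t'<:t''$. Well-formedness. $\Delta$ is well-formed if (acyclic inheritance) $\gamma(\boldsymbol{\tau})\rightarrowtail^+\gamma'(\boldsymbol{\tau}')$ implies $\gamma\ne\gamma'$; and (valid variance) for each declaration $\gamma(\boldsymbol{\diamond x}):\tau_1,\dots,\tau_m$, $\boldsymbol{\diamond x}\vdash\tau_j$ for all $j$, where $\boldsymbol{\diamond x}\vdash x_i$ iff $\diamond_i\in\{\circ,+\}$, and $\boldsymbol{\diamond x}\vdash\gamma'(\tau'_1,\dots,\tau'_n)$ iff for all $i$: $\mathrm{var}_i(\gamma')\in\{\circ,+\}$ implies $\boldsymbol{\diamond x}\vdash\tau'_i$, and $\mathrm{var}_i(\gamma')\in\{\circ,-\}$ implies $\neg\boldsymbol{\diamond x}\vdash\tau'_i$; here $\neg\boldsymbol{\diamond x}$ swaps $+$ and $-$ and leaves $\circ$ fixed. Features and fragments. A set of ground types is closed under inheritance and decomposition if for each $\gamma(\boldsymbol{t})$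 in it, it contains all the $t_i$ and all $t'$ with $\gamma(\boldsymbol{t})\rightarrowtail t'$; $\mathrm{cl}(T)$ is the least such set containing $T$. For $S\subseteq\{C,X,M\}$, a class table conforms to the type system $\mathcal{T}_S$, written $\mathcal{T}_S\vdash\Delta$, if it is well-formed and: if $C\notin S$, no parameter is contravariant; if $X\notin S$, $\Delta$ is non-expansive, i.e., $\mathrm{cl}(T)$ is finite for every finite set $T$ of ground types; if $M\notin S$, $\Delta$ has single instantiation inheritance, i.e., $\gamma(\boldsymbol{x}):^+\gamma'(\boldsymbol{\tau})$ and $\gamma(\boldsymbol{x}):^+\gamma'(\boldsymbol{\tau}')$ imply $\boldsymbol{\tau}=\boldsymbol{\tau}'$. Thus $\mathcal{T}_{\{C,M\}}$ consists of the well-formed non-expansive class tables, and $\mathcal{T}_{\{M\}}$ of those among them without contravariant parameters. Languages. For a class table $\Delta$ over $\Gamma$, a ground type $t_\bot\in\Gamma^{\triangle}$ and a super-alphabet $\Sigma_\top\subseteq\Gamma$, $L_{t_\bot}(\Delta)=\{t_\top\in\Sigma_\top^{\triangle}\mid t_\bot<:t_\top\}$. $\mathcal{L}(\mathcal{T}_S)$ is the class of all forests $L_{t_\bot}(\Delta)$ with $\mathcal{T}_S\vdash\Delta$ (over all choices of $\Gamma,\Delta,t_\bot,\Sigma_\top$). Regular forests. A regular tree grammar is $G=\langle\Sigma,V,v_0,R\rangle$ with $\Sigma$ a finite ranked alphabet, $V$ a finite set of variables of rank $0$ disjoint from $\Sigma$, $v_0\in V$, and $R$ a finite set of productions $v::=\sigma(v_1,\dots,v_n)$,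 $\sigma\in\Sigma$ of rank $n$, $v,v_i\in V$. One derivation step replaces one occurrence of $v$ in a tree by the right-hand side of a production for $v$; $L(G)=\{t\in\Sigma^{\triangle}\mid v_0\to_G^*t\}$. NRF is the class of forests $L(G)$, $G$ a regular tree grammar (regular forests). *)

theory Defs
  imports Main
begin

text \<open>
  Class names, alphabet symbols and grammar variables are drawn from one symbol type
  \<open>'a\<close>, so that the forests of all class tables and of all grammars live in one type.
  Parameters come from the countable supply \<^typ>\<open>nat\<close>; the constructor \<open>Par\<close> keeps
  them disjoint from all symbols.
\<close>

datatype 'a trm = Par nat | Node 'a "'a trm list"

text \<open>
  A ranked alphabet is a finite set \<open>A\<close> with a rank function (relevant only on \<open>A\<close>).
  \<open>terms A rk P\<close> are the terms over \<open>A\<close> and the parameters in \<open>P\<close>.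
\<close>

inductive_set "terms" :: "'a set \<Rightarrow> ('a \<Rightarrow> nat) \<Rightarrow> nat set \<Rightarrow> 'a trm set"
  for A :: "'a set" and rk :: "'a \<Rightarrow> nat" and P :: "nat set" where
  Par: "x \<in> P \<Longrightarrow> Par x \<in> terms A rk P"
| Node: "\<lbrakk>f \<in> A; length ts = rk f; \<forall>t\<in>set ts. t \<in> terms A rk P\<rbrakk> \<Longrightarrow> Node f ts \<in> terms A rk P"

abbreviation ground_terms :: "'a set \<Rightarrow> ('a \<Rightarrow> nat) \<Rightarrow> 'a trm set" where
  "ground_terms A rk \<equiv> terms A rk {}"

primrec subst :: "(nat \<Rightarrow> 'a trm) \<Rightarrow> 'a trm \<Rightarrow> 'a trm" where
  "subst \<theta> (Par x) = \<theta> x"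
| "subst \<theta> (Node f ts) = Node f (map (subst \<theta>) ts)"

definition par_subst :: "'a trm \<Rightarrow> nat list \<Rightarrow> 'a trm list \<Rightarrow> 'a trm" where
  "par_subst \<tau> xs ts =
     subst (\<lambda>x. case map_of (zip xs ts) x of Some t \<Rightarrow> t | None \<Rightarrow> Par x) \<tau>"


section \<open>Class tables\<close>

datatype variance = Inv | Cov | Contra

record 'a class_table =
  classes :: "'a set"
  params :: "'a \<Rightarrow> (variance \<times> nat) list"
  supers :: "'a \<Rightarrow> 'a trm list"

definition rank :: "'a class_table \<Rightarrow> 'a \<Rightarrow> nat" where
  "rank \<Delta> \<gamma> = length (params \<Delta> \<gamma>)"

definition par_names :: "'a class_table \<Rightarrow> 'a \<Rightarrow> nat list" where
  "par_names \<Delta> \<gamma> = map snd (params \<Delta> \<gamma>)"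

definition var :: "'a class_table \<Rightarrow> 'a \<Rightarrow> nat \<Rightarrow> variance" where
  "var \<Delta> \<gamma> i = fst (params \<Delta> \<gamma> ! i)"

definition is_class_table :: "'a class_table \<Rightarrow> bool" where
  "is_class_table \<Delta> \<longleftrightarrow>
     finite (classes \<Delta>) \<and>
     (\<forall>\<gamma>\<in>classes \<Delta>.
        distinct (par_names \<Delta> \<gamma>) \<and>
        (\<forall>\<tau>\<in>set (supers \<Delta> \<gamma>).
           \<tau> \<in> terms (classes \<Delta>) (rank \<Delta>) (set (par_names \<Delta> \<gamma>)) \<and>
           (\<forall>x. \<tau> \<noteq> Par x)))"

definition ground_types :: "'a class_table \<Rightarrow> 'a trm set" where
  "ground_types \<Delta> = ground_terms (classes \<Delta>) (rank \<Delta>)"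


section \<open>Inheritance\<close>

text \<open>
  Inheritance is defined on all types, possibly containing parameters; from a ground type
  it leads to ground types only.
\<close>

inductive inherits :: "'a class_table \<Rightarrow> 'a trm \<Rightarrow> 'a trm \<Rightarrow> bool"
  for \<Delta> :: "'a class_table" where
  "\<lbrakk>Node \<gamma> ts \<in> terms (classes \<Delta>) (rank \<Delta>) UNIV; \<tau> \<in> set (supers \<Delta> \<gamma>)\<rbrakk>
   \<Longrightarrow> inherits \<Delta> (Node \<gamma> ts) (par_subst \<tau> (par_names \<Delta> \<gamma>) ts)"

text \<open>
  \<open>class_inh_star \<Delta> \<gamma> \<tau>\<close> is \<open>\<gamma>(x) :\<^sup>* \<tau>\<close>, where \<open>x\<close> are the declared parameters of
  \<open>\<gamma>\<close>; likewise for \<open>:\<^sup>+\<close>.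
\<close>

inductive class_inh_star :: "'a class_table \<Rightarrow> 'a \<Rightarrow> 'a trm \<Rightarrow> bool"
  for \<Delta> :: "'a class_table" where
  refl: "\<gamma> \<in> classes \<Delta> \<Longrightarrow> class_inh_star \<Delta> \<gamma> (Node \<gamma> (map Par (par_names \<Delta> \<gamma>)))"
| step: "\<lbrakk>\<gamma> \<in> classes \<Delta>; Node \<gamma>' \<tau>s \<in> set (supers \<Delta> \<gamma>); class_inh_star \<Delta> \<gamma>' \<tau>\<rbrakk>
   \<Longrightarrow> class_inh_star \<Delta> \<gamma> (par_subst \<tau> (par_names \<Delta> \<gamma>') \<tau>s)"

inductive class_inh_plus :: "'a class_table \<Rightarrow> 'a \<Rightarrow> 'a trm \<Rightarrow> bool"
  for \<Delta> :: "'a class_table" where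
  "\<lbrakk>\<gamma> \<in> classes \<Delta>; Node \<gamma>' \<tau>s \<in> set (supers \<Delta> \<gamma>); class_inh_star \<Delta> \<gamma>' \<tau>\<rbrakk>
   \<Longrightarrow> class_inh_plus \<Delta> \<gamma> (par_subst \<tau> (par_names \<Delta> \<gamma>') \<tau>s)"


section \<open>Subtyping\<close>

inductive subtype :: "'a class_table \<Rightarrow> 'a trm \<Rightarrow> 'a trm \<Rightarrow> bool"
  for \<Delta> :: "'a class_table" where
  Var: "\<lbrakk>Node \<gamma> ts \<in> ground_types \<Delta>; Node \<gamma> ts' \<in> ground_types \<Delta>;
         \<forall>i<rank \<Delta> \<gamma>.
           (var \<Delta> \<gamma> i = Cov \<longrightarrow> subtype \<Delta> (ts ! i) (ts' ! i)) \<and>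
           (var \<Delta> \<gamma> i = Inv \<longrightarrow> ts ! i = ts' ! i) \<and>
           (var \<Delta> \<gamma> i = Contra \<longrightarrow> subtype \<Delta> (ts' ! i) (ts ! i))\<rbrakk>
        \<Longrightarrow> subtype \<Delta> (Node \<gamma> ts) (Node \<gamma> ts')"
| Super: "\<lbrakk>t \<in> ground_types \<Delta>; inherits \<Delta> t t'; subtype \<Delta> t' t''\<rbrakk> \<Longrightarrow> subtype \<Delta> t t''"


section \<open>Well-formedness\<close>

definition acyclic_inheritance :: "'a class_table \<Rightarrow> bool" where
  "acyclic_inheritance \<Delta> \<longleftrightarrow>
     (\<forall>\<gamma> \<tau>s \<gamma>' \<tau>s'. (inherits \<Delta>)\<^sup>+\<^sup>+ (Node \<gamma> \<tau>s) (Node \<gamma>' \<tau>s') \<longrightarrow> \<gamma> \<noteq> \<gamma>')"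

primrec neg_variance :: "variance \<Rightarrow> variance" where
  "neg_variance Inv = Inv"
| "neg_variance Cov = Contra"
| "neg_variance Contra = Cov"

definition neg_params :: "(variance \<times> nat) list \<Rightarrow> (variance \<times> nat) list" where
  "neg_params dxs = map (\<lambda>(d, x). (neg_variance d, x)) dxs"

text \<open>
  The judgement \<open>\<diamond>x \<turnstile> \<tau>\<close>. The negation in \<open>\<not>\<diamond>x \<turnstile> \<tau>\<close> acts on the context \<open>\<diamond>x\<close>
  and not on the judgement, so the structural recursion on \<open>\<tau>\<close> is a monotone inductive
  definition.
\<close>

inductive valid_variance :: "'a class_table \<Rightarrow> (variance \<times> nat) list \<Rightarrow> 'a trm \<Rightarrow> bool"
  for \<Delta> :: "'a class_table" where
  Par: "\<lbrakk>(d, x) \<in> set dxs; d \<in> {Inv, Cov}\<rbrakk> \<Longrightarrow> valid_variance \<Delta> dxs (Par x)"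
| Node: "\<forall>i<length \<tau>s.
           (var \<Delta> \<gamma> i \<in> {Inv, Cov} \<longrightarrow> valid_variance \<Delta> dxs (\<tau>s ! i)) \<and>
           (var \<Delta> \<gamma> i \<in> {Inv, Contra} \<longrightarrow> valid_variance \<Delta> (neg_params dxs) (\<tau>s ! i))
         \<Longrightarrow> valid_variance \<Delta> dxs (Node \<gamma> \<tau>s)"

definition well_formed :: "'a class_table \<Rightarrow> bool" where
  "well_formed \<Delta> \<longleftrightarrow>
     acyclic_inheritance \<Delta> \<and>
     (\<forall>\<gamma>\<in>classes \<Delta>. \<forall>\<tau>\<in>set (supers \<Delta> \<gamma>). valid_variance \<Delta> (params \<Delta> \<gamma>) \<tau>)"


section \<open>Type systems\<close>

inductive_set cl :: "'a class_table \<Rightarrow> 'a trm set \<Rightarrow> 'a trm set"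
  for \<Delta> :: "'a class_table" and T :: "'a trm set" where
  base: "t \<in> T \<Longrightarrow> t \<in> cl \<Delta> T"
| decomp: "\<lbrakk>Node \<gamma> ts \<in> cl \<Delta> T; t \<in> set ts\<rbrakk> \<Longrightarrow> t \<in> cl \<Delta> T"
| inherit: "\<lbrakk>t \<in> cl \<Delta> T; inherits \<Delta> t t'\<rbrakk> \<Longrightarrow> t' \<in> cl \<Delta> T"

definition contravariance_free :: "'a class_table \<Rightarrow> bool" where
  "contravariance_free \<Delta> \<longleftrightarrow>
     (\<forall>\<gamma>\<in>classes \<Delta>. \<forall>i<rank \<Delta> \<gamma>. var \<Delta> \<gamma> i \<noteq> Contra)"

definition non_expansive :: "'a class_table \<Rightarrow> bool" where
  "non_expansive \<Delta> \<longleftrightarrow> (\<forall>T. T \<subseteq> ground_types \<Delta> \<and> finite T \<longrightarrow> finite (cl \<Delta> T))"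

definition single_instantiation :: "'a class_table \<Rightarrow> bool" where
  "single_instantiation \<Delta> \<longleftrightarrow>
     (\<forall>\<gamma> \<gamma>' \<tau>s \<tau>s'. class_inh_plus \<Delta> \<gamma> (Node \<gamma>' \<tau>s) \<and> class_inh_plus \<Delta> \<gamma> (Node \<gamma>' \<tau>s')
        \<longrightarrow> \<tau>s = \<tau>s')"

text \<open>The features \<open>C\<close> (contravariance), \<open>X\<close> (expansiveness), \<open>M\<close> (multiple instantiation).\<close>

datatype feature = FeatC | FeatX | FeatM

definition conforms :: "feature set \<Rightarrow> 'a class_table \<Rightarrow> bool" where
  "conforms S \<Delta> \<longleftrightarrow>
     is_class_table \<Delta> \<and> well_formed \<Delta> \<and>
     (FeatC \<notin> S \<longrightarrow> contravariance_free \<Delta>) \<and>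
     (FeatX \<notin> S \<longrightarrow> non_expansive \<Delta>) \<and>
     (FeatM \<notin> S \<longrightarrow> single_instantiation \<Delta>)"

definition ct_language :: "'a class_table \<Rightarrow> 'a trm \<Rightarrow> 'a set \<Rightarrow> 'a trm set" where
  "ct_language \<Delta> t\<^sub>b \<Sigma>\<^sub>t = {t \<in> ground_terms \<Sigma>\<^sub>t (rank \<Delta>). subtype \<Delta> t\<^sub>b t}"

definition ct_languages :: "feature set \<Rightarrow> 'a trm set set" where
  "ct_languages S =
     {ct_language \<Delta> t\<^sub>b \<Sigma>\<^sub>t | \<Delta> t\<^sub>b \<Sigma>\<^sub>t.
        conforms S \<Delta> \<and> t\<^sub>b \<in> ground_types \<Delta> \<and> \<Sigma>\<^sub>t \<subseteq> classes \<Delta>}"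


section \<open>Regular forests\<close>

text \<open>A production \<open>v ::= \<sigma>(v\<^sub>1, \<dots>, v\<^sub>n)\<close> is the triple \<open>(v, \<sigma>, [v\<^sub>1, \<dots>, v\<^sub>n])\<close>.\<close>

record 'a grammar =
  alphabet :: "'a set"
  arity :: "'a \<Rightarrow> nat"
  variables :: "'a set"
  start :: 'a
  prods :: "('a \<times> 'a \<times> 'a list) set"

definition is_grammar :: "'a grammar \<Rightarrow> bool" where
  "is_grammar G \<longleftrightarrow>
     finite (alphabet G) \<and> finite (variables G) \<and> alphabet G \<inter> variables G = {} \<and>
     start G \<in> variables G \<and> finite (prods G) \<and>
     (\<forall>(v, \<sigma>, vs)\<in>prods G.
        v \<in> variables G \<and> \<sigma> \<in> alphabet G \<and> length vs = arity G \<sigma> \<and> set vs \<subseteq> variables G)"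

text \<open>A variable \<open>v\<close>, being a symbol of rank 0, occurs in trees as \<open>Node v []\<close>.\<close>

inductive derives :: "'a grammar \<Rightarrow> 'a trm \<Rightarrow> 'a trm \<Rightarrow> bool"
  for G :: "'a grammar" where
  root: "(v, \<sigma>, vs) \<in> prods G \<Longrightarrow> derives G (Node v []) (Node \<sigma> (map (\<lambda>w. Node w []) vs))"
| arg: "derives G t t' \<Longrightarrow> derives G (Node f (us @ t # ws)) (Node f (us @ t' # ws))"

definition grammar_language :: "'a grammar \<Rightarrow> 'a trm set" where
  "grammar_language G =
     {t \<in> ground_terms (alphabet G) (arity G). (derives G)\<^sup>*\<^sup>* (Node (start G) []) t}"

definition NRF :: "'a trm set set" where
  "NRF = {grammar_language G | G. is_grammar G}"

end

theory Submission imports Defs begin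

text \<open>
  A grammar becomes a class table by turning each variable into a nullary class that inherits
  from the right-hand sides of its productions, all alphabet symbols being covariant.

  Conversely, let \<open>W\<close> be the finite closure of the starting type under inheritance and
  decomposition, and let the profile of a ground type record which elements of \<open>W\<close> are its
  subtypes, its supertypes, or equal to it. Deriving \<open>w <: t\<close> or \<open>t <: w\<close> with \<open>w \<in> W\<close> only
  ever compares a type built from \<open>t\<close> with an element of \<open>W\<close>, so the profile of a type
  depends only on its root and on the profiles of its arguments. Having the same profile is thus
  a congruence of finite index that saturates the language.
\<close>

section \<open>Terms\<close>

lemma Node_in_terms_iff:
  "Node f ts \<in> terms A rk P \<longleftrightarrow> f \<in> A \<and> length ts = rk f \<and> set ts \<subseteq> terms A rk P"
  by (auto elim: terms.cases intro: terms.Node)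

lemma Par_in_terms_iff: "Par x \<in> terms A rk P \<longleftrightarrow> x \<in> P"
  by (auto elim: terms.cases intro: terms.Par)

lemma terms_cong:
  assumes "\<And>f. f \<in> A \<Longrightarrow> rk f = rk' f"
  shows "terms A rk P = terms A rk' P"
proof -
  have "t \<in> terms A rk P \<longleftrightarrow> t \<in> terms A rk' P" for t
    by (induction t) (auto simp: Node_in_terms_iff Par_in_terms_iff assms)
  then show ?thesis by blast
qed

lemma terms_mono:
  assumes "A \<subseteq> B" "P \<subseteq> Q"
  shows "terms A rk P \<subseteq> terms B rk Q"
proof
  show "t \<in> terms B rk Q" if "t \<in> terms A rk P" for t
    using that by induction (use assms in \<open>auto intro!: terms.intros\<close>)
qed

lemma subst_in_terms:
  assumes "t \<in> terms A rk P" "\<And>x. x \<in> P \<Longrightarrow> \<theta> x \<in> terms A rk Q"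
  shows "subst \<theta> t \<in> terms A rk Q"
  using assms(1) by induction (auto simp: Node_in_terms_iff assms(2))

lemma subst_cong_terms:
  assumes "t \<in> terms A rk P" "\<And>x. x \<in> P \<Longrightarrow> \<theta> x = \<theta>' x"
  shows "subst \<theta> t = subst \<theta>' t"
  using assms(1) by induction (auto simp: assms(2))

lemma subst_subst: "subst \<theta> (subst \<rho> t) = subst (subst \<theta> \<circ> \<rho>) t"
  by (induction t) auto

text \<open>Equal lengths give every name in \<open>xs\<close> a value from \<open>ts\<close>, so
  the default \<open>Par x\<close> of \<open>par_subst\<close> is never reached.\<close>

lemma par_subst_in_terms:
  assumes "t \<in> terms A rk (set xs)" "length ts = length xs" "set ts \<subseteq> terms A rk Q"
  shows "par_subst t xs ts \<in> terms A rk Q"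
  unfolding par_subst_def
proof (rule subst_in_terms[OF assms(1)])
  fix x assume "x \<in> set xs"
  then obtain s where "map_of (zip xs ts) x = Some s"
    using assms(2) by (metis map_of_zip_is_Some)
  moreover from this have "s \<in> set ts"
    by (meson map_of_SomeD set_zip_rightD)
  ultimately show "(case map_of (zip xs ts) x of None \<Rightarrow> Par x | Some s \<Rightarrow> s) \<in> terms A rk Q"
    using assms(3) by auto
qed

text \<open>This makes inheritance commute with instantiation. A parameter of \<open>t\<close>
  outside \<open>xs\<close> would be hit by \<open>\<theta>\<close> on the left only, hence the
  restriction on \<open>t\<close>.\<close>

lemma subst_par_subst:
  assumes "t \<in> terms A rk (set xs)" "length ts = length xs"
  shows "subst \<theta> (par_subst t xs ts) = par_subst t xs (map (subst \<theta>) ts)"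
  unfolding par_subst_def subst_subst
proof (rule subst_cong_terms[OF assms(1)])
  fix x assume "x \<in> set xs"
  then obtain s where "map_of (zip xs ts) x = Some s"
    using assms(2) by (metis map_of_zip_is_Some)
  then show "(subst \<theta> \<circ> (\<lambda>x. case map_of (zip xs ts) x of None \<Rightarrow> Par x | Some s \<Rightarrow> s)) x =
      (case map_of (zip xs (map (subst \<theta>) ts)) x of None \<Rightarrow> Par x | Some s \<Rightarrow> s)"
    by (simp add: zip_map2 map_of_map[unfolded comp_def])
qed

text \<open>Serves to enclose closures under decomposition in a finite set.\<close>

primrec subterms :: "'a trm \<Rightarrow> 'a trm set" where
  "subterms (Par x) = {Par x}"
| "subterms (Node f ts) = insert (Node f ts) (\<Union> (set (map subterms ts)))"

lemma finite_subterms [simp]: "finite (subterms t)"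
  by (induction t) auto

lemma subterms_refl [simp]: "t \<in> subterms t"
  by (cases t) auto

lemma arg_in_subterms: "Node f ts \<in> subterms s \<Longrightarrow> t \<in> set ts \<Longrightarrow> t \<in> subterms s"
  by (induction s) (auto, metis subterms_refl)


section \<open>Derivations of regular tree grammars\<close>

text \<open>A big-step form of derivation. The rule \<open>node\<close> extends it from single
  variables to mixed trees of letters and variables, so that a derivation step can be
  prepended.\<close>

inductive generates :: "'a grammar \<Rightarrow> 'a trm \<Rightarrow> 'a trm \<Rightarrow> bool"
  for G :: "'a grammar" where
  prod: "\<lbrakk>(v, \<sigma>, vs) \<in> prods G; list_all2 (\<lambda>w. generates G (Node w [])) vs ts\<rbrakk>
   \<Longrightarrow> generates G (Node v []) (Node \<sigma> ts)"
| node: "\<lbrakk>f \<in> alphabet G; list_all2 (generates G) ss ts\<rbrakk>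
   \<Longrightarrow> generates G (Node f ss) (Node f ts)"

lemma generates_refl:
  "t \<in> ground_terms (alphabet G) rk \<Longrightarrow> generates G t t"
proof (induction t)
  case (Node f ts)
  then show ?case
    by (auto simp: Node_in_terms_iff intro!: generates.node list.rel_refl_strong)
qed (simp add: Par_in_terms_iff)

lemma derives_generates:
  assumes "is_grammar G" "derives G s t" "generates G t u"
  shows "generates G s u"
  using assms(2,3)
proof (induction arbitrary: u)
  case (root v \<sigma> vs)
  \<comment> \<open>If \<open>vs\<close> is empty, the right-hand side is a leaf, just like a
    variable. Disjointness of letters and variables excludes \<open>prod\<close> for it, so
    \<open>u\<close> arises by \<open>node\<close>.\<close>
  have "\<sigma> \<in> alphabet G" "alphabet G \<inter> variables G = {}"
    using assms(1) root(1) by (auto simp: is_grammar_def)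
  moreover have "w \<in> variables G" if "(w, \<tau>) \<in> prods G" for w \<tau>
    using assms(1) that by (auto simp: is_grammar_def)
  ultimately obtain ts where "u = Node \<sigma> ts"
      "list_all2 (generates G) (map (\<lambda>w. Node w []) vs) ts"
    using root(2) by (auto elim!: generates.cases)
  then show ?case
    using root(1) by (auto simp: list.rel_map intro: generates.prod)
next
  case (arg s t f us ws)
  \<comment> \<open>An argument list containing \<open>t\<close> is not empty, so the tree is not a
    variable and only \<open>node\<close> applies.\<close>
  from arg.prems obtain ts where f: "f \<in> alphabet G" and u: "u = Node f ts"
      and "list_all2 (generates G) (us @ t # ws) ts"
    by cases auto
  then have "list_all2 (generates G) (us @ s # ws) ts"
    by (auto simp: list_all2_append1 list_all2_Cons1 intro!: arg.IH)
  with f u show ?case by (auto intro: generates.node)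
qed

lemma derives_star_arg:
  "(derives G)\<^sup>*\<^sup>* s t \<Longrightarrow> (derives G)\<^sup>*\<^sup>* (Node f (us @ s # ws)) (Node f (us @ t # ws))"
  by (induction rule: rtranclp_induct) (auto intro: derives.arg rtranclp.rtrancl_into_rtrancl)

text \<open>Arguments are rewritten from left to right; the prefix \<open>us\<close> collects those
  already finished.\<close>

lemma derives_star_args:
  assumes "list_all2 (derives G)\<^sup>*\<^sup>* ss ts"
  shows "(derives G)\<^sup>*\<^sup>* (Node f (us @ ss)) (Node f (us @ ts))"
  using assms
proof (induction arbitrary: us rule: list_all2_induct)
  case (Cons s ss t ts)
  have "(derives G)\<^sup>*\<^sup>* (Node f (us @ s # ss)) (Node f (us @ t # ss))"
    using Cons(1) by (rule derives_star_arg)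
  also have "(derives G)\<^sup>*\<^sup>* \<dots> (Node f (us @ t # ts))"
    using Cons(3)[of "us @ [t]"] by simp
  finally show ?case .
qed simp

lemma generates_derives_star: "generates G s t \<Longrightarrow> (derives G)\<^sup>*\<^sup>* s t"
proof (induction rule: generates.induct)
  case (prod v \<sigma> vs ts)
  have "list_all2 (derives G)\<^sup>*\<^sup>* (map (\<lambda>w. Node w []) vs) ts"
    using prod(2) by (auto simp: list.rel_map elim: list.rel_mono_strong)
  from derives_star_args[OF this, of \<sigma> "[]"] show ?case
    using derives.root[OF prod(1)] by (simp add: converse_rtranclp_into_rtranclp)
next
  case (node f ss ts)
  have "list_all2 (derives G)\<^sup>*\<^sup>* ss ts"
    using node(2) by (auto elim: list.rel_mono_strong)
  from derives_star_args[OF this, of f "[]"] show ?case by simp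
qed

lemma derives_star_iff_generates:
  assumes "is_grammar G" "t \<in> ground_terms (alphabet G) (arity G)"
  shows "(derives G)\<^sup>*\<^sup>* s t \<longleftrightarrow> generates G s t"
proof
  assume "(derives G)\<^sup>*\<^sup>* s t"
  then show "generates G s t"
    by (induction rule: converse_rtranclp_induct)
      (auto intro: generates_refl[OF assms(2)] derives_generates[OF assms(1)])
qed (rule generates_derives_star)

text \<open>Reading off the first production gives a recursion on the derived tree. Both inclusions
  between the language classes access derivations through this equivalence.\<close>

lemma derives_star_Node_iff:
  assumes G: "is_grammar G" and v: "v \<in> variables G"
    and t: "Node f ts \<in> ground_terms (alphabet G) (arity G)"
  shows "(derives G)\<^sup>*\<^sup>* (Node v []) (Node f ts) \<longleftrightarrow>
    (\<exists>vs. (v, f, vs) \<in> prods G \<and> list_all2 (\<lambda>w. (derives G)\<^sup>*\<^sup>* (Node w [])) vs ts)"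
proof -
  have "v \<notin> alphabet G"
    using G v by (auto simp: is_grammar_def)
  then have "generates G (Node v []) (Node f ts) \<longleftrightarrow>
      (\<exists>vs. (v, f, vs) \<in> prods G \<and> list_all2 (\<lambda>w. generates G (Node w [])) vs ts)"
    by (auto elim: generates.cases intro: generates.prod)
  moreover have "list_all2 (\<lambda>w. generates G (Node w [])) vs ts \<longleftrightarrow>
      list_all2 (\<lambda>w. (derives G)\<^sup>*\<^sup>* (Node w [])) vs ts" for vs
    using t by (intro list.rel_cong refl)
      (auto simp: Node_in_terms_iff derives_star_iff_generates[OF G])
  ultimately show ?thesis
    by (simp add: derives_star_iff_generates[OF G t])
qed


section \<open>Forests recognized by a congruence of finite index\<close>

text \<open>The easy half of the Myhill-Nerode theorem for trees: the values of \<open>h\<close> are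
  the states of a bottom-up automaton, read backwards as a grammar. The symbol type must be infinite
  to supply fresh symbols for the states.\<close>

lemma recognizable_imp_NRF:
  fixes h :: "'a trm \<Rightarrow> 'q" and A :: "'a set"
  assumes inf: "infinite (UNIV :: 'a set)"
    and A: "finite A"
    and fin: "finite (h ` ground_terms A rk)"
    and cong: "\<And>f ss ts. \<lbrakk>Node f ss \<in> ground_terms A rk; Node f ts \<in> ground_terms A rk;
      map h ss = map h ts\<rbrakk> \<Longrightarrow> h (Node f ss) = h (Node f ts)"
    and L: "L \<subseteq> ground_terms A rk"
    and sat: "\<And>s t. \<lbrakk>s \<in> L; t \<in> ground_terms A rk; h s = h t\<rbrakk> \<Longrightarrow> t \<in> L"
  shows "L \<in> NRF"
proof -
  let ?T = "ground_terms A rk"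
  \<comment> \<open>\<open>None\<close> stands for an extra start variable: \<open>L\<close> may be
    a union of several classes, so no single class need generate it.\<close>
  define Q where "Q = insert None (Some ` h ` ?T)"
  have finQ: "finite Q" by (simp add: Q_def fin)
  have "infinite (- A)"
    using inf A by (simp add: Compl_eq_Diff_UNIV Diff_infinite_finite)
  then obtain V where V: "V \<subseteq> - A" "finite V" "card V = card Q"
    using infinite_arbitrarily_large by blast
  obtain e where e: "bij_betw e Q V"
    using V finQ by (metis finite_same_card_bij)
  define q where "q t = e (Some (h t))" for t
  have q_in: "q t \<in> V" if "t \<in> ?T" for t
    using that bij_betwE[OF e] by (auto simp: q_def Q_def)
  have q_eq: "q s = q t \<longleftrightarrow> h s = h t" if "s \<in> ?T" "t \<in> ?T" for s t
    using that inj_onD[OF bij_betw_imp_inj_on[OF e], of "Some (h s)" "Some (h t)"]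
    by (auto simp: q_def Q_def)
  have q_None: "e None \<noteq> q t" if "t \<in> ?T" for t
    using that inj_onD[OF bij_betw_imp_inj_on[OF e], of None "Some (h t)"]
    by (auto simp: q_def Q_def)
  have None_in: "e None \<in> V"
    using bij_betwE[OF e] by (auto simp: Q_def)
  \<comment> \<open>The first set lets the variable of each class produce the roots of its members;
    the second gives the start variable the productions of all members of \<open>L\<close>.\<close>
  define R where "R = {(q (Node f ts), f, map q ts) | f ts. Node f ts \<in> ?T} \<union>
    {(e None, f, map q ts) | f ts. Node f ts \<in> L}"
  define G where "G = \<lparr>alphabet = A, arity = rk, variables = V, start = e None, prods = R\<rparr>"
  have R: "v \<in> V \<and> f \<in> A \<and> length vs = rk f \<and> set vs \<subseteq> V" if "(v, f, vs) \<in> R" for v f vs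
  proof -
    from that obtain ts where ts: "Node f ts \<in> ?T" "vs = map q ts" "v = q (Node f ts) \<or> v = e None"
      using L by (auto simp: R_def)
    then show ?thesis
      using q_in None_in by (auto simp: Node_in_terms_iff)
  qed
  have R_state: "(q s, f, vs) \<in> R \<longleftrightarrow> (\<exists>ss. Node f ss \<in> ?T \<and> h s = h (Node f ss) \<and> vs = map q ss)"
    if "s \<in> ?T" for s f vs
    unfolding R_def using q_eq[OF that] q_None[OF that] by auto
  have R_start: "(e None, f, vs) \<in> R \<longleftrightarrow> (\<exists>ss. Node f ss \<in> L \<and> vs = map q ss)" for f vs
    unfolding R_def using q_None by auto
  \<comment> \<open>There may be infinitely many trees \<open>Node f ts\<close>, but their
    productions use only finitely many variables and letters of fixed rank.\<close>
  have "finite R"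
  proof (rule finite_subset)
    show "R \<subseteq> V \<times> (SIGMA f : A. {vs. set vs \<subseteq> V \<and> length vs = rk f})"
      using R by auto
    show "finite (V \<times> (SIGMA f : A. {vs. set vs \<subseteq> V \<and> length vs = rk f}))"
      using V(2) A by (auto intro: finite_lists_length_eq)
  qed
  then have G: "is_grammar G"
    using A V None_in unfolding is_grammar_def by (auto simp: G_def dest: R)
  \<comment> \<open>Correctness for the arguments is a premise here, so that the fact serves with
    the induction hypothesis first and with the finished result \<open>state\<close>
    afterwards.\<close>
  have args: "list_all2 (\<lambda>w. (derives G)\<^sup>*\<^sup>* (Node w [])) (map q ss) ts \<longleftrightarrow> map h ss = map h ts"
    if "Node f ss \<in> ?T" "Node f ts \<in> ?T"
      "\<And>s t. t \<in> set ts \<Longrightarrow> s \<in> ?T \<Longrightarrow> t \<in> ?T \<Longrightarrow> (derives G)\<^sup>*\<^sup>* (Node (q s) []) t \<longleftrightarrow> h s = h t"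
    for f ss ts
  proof -
    have "list_all2 (\<lambda>w. (derives G)\<^sup>*\<^sup>* (Node w [])) (map q ss) ts \<longleftrightarrow>
        list_all2 (\<lambda>s t. h s = h t) ss ts"
      unfolding list.rel_map
      by (intro list.rel_cong refl) (use that in \<open>auto simp: Node_in_terms_iff\<close>)
    also have "\<dots> \<longleftrightarrow> map h ss = map h ts"
      by (auto simp: list_eq_iff_nth_eq list_all2_conv_all_nth)
    finally show ?thesis .
  qed
  have state: "(derives G)\<^sup>*\<^sup>* (Node (q s) []) t \<longleftrightarrow> h s = h t" if "s \<in> ?T" "t \<in> ?T" for s t
    using that
  proof (induction t arbitrary: s rule: trm.induct)
    case (Node f ts)
    note args = args[OF _ Node.prems(2) Node.IH]
    have "(derives G)\<^sup>*\<^sup>* (Node (q s) []) (Node f ts) \<longleftrightarrow> (\<exists>vs. (q s, f, vs) \<in> R \<and>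
        list_all2 (\<lambda>w. (derives G)\<^sup>*\<^sup>* (Node w [])) vs ts)"
      using derives_star_Node_iff[OF G, of "q s" f ts] Node.prems q_in by (simp add: G_def)
    also have "\<dots> \<longleftrightarrow> (\<exists>ss. Node f ss \<in> ?T \<and> h s = h (Node f ss) \<and> map h ss = map h ts)"
      unfolding R_state[OF Node.prems(1)] using args by blast
    \<comment> \<open>The congruence property makes the choice of \<open>ss\<close> irrelevant;
      conversely \<open>ts\<close> itself is a witness.\<close>
    also have "\<dots> \<longleftrightarrow> h s = h (Node f ts)"
      using cong Node.prems by metis
    finally show ?case .
  qed (simp add: Par_in_terms_iff)
  have "(derives G)\<^sup>*\<^sup>* (Node (e None) []) t \<longleftrightarrow> t \<in> L" if t: "t \<in> ?T" for t
  proof (cases t)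
    case (Node f ts)
    note args = args[OF _ t[unfolded Node] state]
    have "(derives G)\<^sup>*\<^sup>* (Node (e None) []) (Node f ts) \<longleftrightarrow> (\<exists>vs. (e None, f, vs) \<in> R \<and>
        list_all2 (\<lambda>w. (derives G)\<^sup>*\<^sup>* (Node w [])) vs ts)"
      using derives_star_Node_iff[OF G, of "e None" f ts] t Node None_in by (simp add: G_def)
    also have "\<dots> \<longleftrightarrow> (\<exists>ss. Node f ss \<in> L \<and> map h ss = map h ts)"
      unfolding R_start using L args by blast
    also have "\<dots> \<longleftrightarrow> Node f ts \<in> L"
      using cong sat t Node L by (metis subsetD)
    finally show ?thesis using Node by simp
  qed (use t in \<open>simp add: Par_in_terms_iff\<close>)
  then have "grammar_language G = L"
    using L by (auto simp: grammar_language_def G_def)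
  with G show ?thesis by (auto simp: NRF_def)
qed


section \<open>Non-expansive class tables define regular forests\<close>

text \<open>The three components answer the comparisons at the three kinds of argument positions;
  the last one, for invariant positions, is \<open>{t}\<close> or empty.\<close>

definition profile :: "'a class_table \<Rightarrow> 'a trm set \<Rightarrow> 'a trm \<Rightarrow> 'a trm set \<times> 'a trm set \<times> 'a trm set"
  where "profile \<Delta> W t = ({w \<in> W. subtype \<Delta> t w}, {w \<in> W. subtype \<Delta> w t}, {w \<in> W. t = w})"

text \<open>Decomposition puts the value of every parameter of \<open>t\<close> into the closure,
  and there the third component of the profile determines the type.\<close>

lemma subst_eq_in_cl:
  assumes "subst \<theta> t \<in> cl \<Delta> T" "\<And>x. profile \<Delta> (cl \<Delta> T) (\<theta> x) = profile \<Delta> (cl \<Delta> T) (\<theta>' x)"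
  shows "subst \<theta>' t = subst \<theta> t"
  using assms(1)
proof (induction t)
  case (Par x)
  then have "\<theta> x \<in> snd (snd (profile \<Delta> (cl \<Delta> T) (\<theta> x)))"
    by (simp add: profile_def)
  then show ?case
    unfolding assms(2) by (simp add: profile_def)
next
  case (Node f ts)
  have "subst \<theta> t \<in> cl \<Delta> T" if "t \<in> set ts" for t
    using cl.decomp[of f "map (subst \<theta>) ts"] Node.prems that by auto
  with Node.IH show ?case by simp
qed

text \<open>In a derivation comparing an instance of \<open>\<tau>\<close> with a member of the
  closure, every premise has this form again, until a parameter is reached and the profile decides.
  Contravariant arguments exchange the sides, so both claims go through one induction. Arbitrary
  \<open>\<tau>\<close> are required because inheritance replaces a root symbol by a deeper
  term.\<close>

lemma subtype_subst:
  assumes \<Delta>: "is_class_table \<Delta>"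
    and prof: "\<And>x. profile \<Delta> (cl \<Delta> T) (\<theta> x) = profile \<Delta> (cl \<Delta> T) (\<theta>' x)"
    and ground: "\<And>x. \<theta>' x \<in> ground_types \<Delta>"
    and sub: "subtype \<Delta> s t"
  shows "\<And>\<tau>. \<lbrakk>\<tau> \<in> terms (classes \<Delta>) (rank \<Delta>) UNIV; s = subst \<theta> \<tau>; t \<in> cl \<Delta> T\<rbrakk>
      \<Longrightarrow> subtype \<Delta> (subst \<theta>' \<tau>) t"
    and "\<And>\<tau>. \<lbrakk>\<tau> \<in> terms (classes \<Delta>) (rank \<Delta>) UNIV; t = subst \<theta> \<tau>; s \<in> cl \<Delta> T\<rbrakk>
      \<Longrightarrow> subtype \<Delta> s (subst \<theta>' \<tau>)"
proof -
  let ?W = "cl \<Delta> T" and ?U = "terms (classes \<Delta>) (rank \<Delta>) UNIV"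
  have below: "subtype \<Delta> (\<theta> x) w \<longleftrightarrow> subtype \<Delta> (\<theta>' x) w" if "w \<in> ?W" for x w
    using prof[of x] that by (auto simp: profile_def)
  have above: "subtype \<Delta> w (\<theta> x) \<longleftrightarrow> subtype \<Delta> w (\<theta>' x)" if "w \<in> ?W" for x w
    using prof[of x] that by (auto simp: profile_def)
  have ground_subst: "subst \<theta>' \<tau> \<in> ground_types \<Delta>" if "\<tau> \<in> ?U" for \<tau>
    using that ground unfolding ground_types_def by (rule subst_in_terms)
  have "(\<forall>\<tau>\<in>?U. s = subst \<theta> \<tau> \<longrightarrow> t \<in> ?W \<longrightarrow> subtype \<Delta> (subst \<theta>' \<tau>) t) \<and>
      (\<forall>\<tau>\<in>?U. t = subst \<theta> \<tau> \<longrightarrow> s \<in> ?W \<longrightarrow> subtype \<Delta> s (subst \<theta>' \<tau>))"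
    using sub
  proof (induction rule: subtype.induct)
    case (Var \<gamma> ts ts')
    \<comment> \<open>The rule's conclusion is rebuilt because, if \<open>\<tau>\<close> is a
      parameter, the whole judgement is looked up in the profile.\<close>
    have whole: "subtype \<Delta> (Node \<gamma> ts) (Node \<gamma> ts')"
      using Var by (intro subtype.Var) blast+
    have len: "length ts = rank \<Delta> \<gamma>" "length ts' = rank \<Delta> \<gamma>"
      using Var(1,2) by (auto simp: ground_types_def Node_in_terms_iff)
    show ?case
    proof (intro conjI ballI impI)
      fix \<tau> assume \<tau>: "\<tau> \<in> ?U" "Node \<gamma> ts = subst \<theta> \<tau>" and W: "Node \<gamma> ts' \<in> ?W"
      show "subtype \<Delta> (subst \<theta>' \<tau>) (Node \<gamma> ts')"
      proof (cases \<tau>)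
        case (Par x)
        then show ?thesis using whole \<tau>(2) below[OF W] by simp
      next
        case (Node f us)
        then have us: "f = \<gamma>" "ts = map (subst \<theta>) us" "length us = rank \<Delta> \<gamma>" using \<tau> len by auto
        have arg: "us ! i \<in> ?U \<and> ts ! i = subst \<theta> (us ! i) \<and> ts' ! i \<in> ?W" if "i < rank \<Delta> \<gamma>" for i
          using that us Node \<tau>(1) len cl.decomp[OF W, of "ts' ! i"]
          by (auto simp: Node_in_terms_iff)
        \<comment> \<open>Covariant arguments use the first half of the induction hypothesis,
          contravariant ones the second, since there the closure member is the smaller side.
          Invariant arguments lie in the closure, where equal profiles force equality.\<close>
        have step: "var \<Delta> \<gamma> i = Cov \<longrightarrow> subtype \<Delta> (subst \<theta>' (us ! i)) (ts' ! i)"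
            "var \<Delta> \<gamma> i = Contra \<longrightarrow> subtype \<Delta> (ts' ! i) (subst \<theta>' (us ! i))"
            "var \<Delta> \<gamma> i = Inv \<longrightarrow> subst \<theta>' (us ! i) = ts' ! i" if "i < rank \<Delta> \<gamma>" for i
          using Var(3) arg[OF that] that subst_eq_in_cl[of \<theta> "us ! i" \<Delta> T \<theta>', OF _ prof] by (blast, blast, metis)
        have "subtype \<Delta> (Node \<gamma> (map (subst \<theta>') us)) (Node \<gamma> ts')"
          using ground_subst[OF \<tau>(1)] Node us Var(2) step
          by (intro subtype.Var) auto
        then show ?thesis using Node us by simp
      qed
    next
      fix \<tau> assume \<tau>: "\<tau> \<in> ?U" "Node \<gamma> ts' = subst \<theta> \<tau>" and W: "Node \<gamma> ts \<in> ?W"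
      show "subtype \<Delta> (Node \<gamma> ts) (subst \<theta>' \<tau>)"
      proof (cases \<tau>)
        case (Par x)
        then show ?thesis using whole \<tau>(2) above[OF W] by simp
      next
        case (Node f us)
        then have us: "f = \<gamma>" "ts' = map (subst \<theta>) us" "length us = rank \<Delta> \<gamma>" using \<tau> len by auto
        have arg: "us ! i \<in> ?U \<and> ts' ! i = subst \<theta> (us ! i) \<and> ts ! i \<in> ?W" if "i < rank \<Delta> \<gamma>" for i
          using that us Node \<tau>(1) len cl.decomp[OF W, of "ts ! i"]
          by (auto simp: Node_in_terms_iff)
        have step: "var \<Delta> \<gamma> i = Cov \<longrightarrow> subtype \<Delta> (ts ! i) (subst \<theta>' (us ! i))"
            "var \<Delta> \<gamma> i = Contra \<longrightarrow> subtype \<Delta> (subst \<theta>' (us ! i)) (ts ! i)"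
            "var \<Delta> \<gamma> i = Inv \<longrightarrow> ts ! i = subst \<theta>' (us ! i)" if "i < rank \<Delta> \<gamma>" for i
          using Var(3) arg[OF that] that subst_eq_in_cl[of \<theta> "us ! i" \<Delta> T \<theta>', OF _ prof] by (blast, blast, metis)
        have "subtype \<Delta> (Node \<gamma> ts) (Node \<gamma> (map (subst \<theta>') us))"
          using ground_subst[OF \<tau>(1)] Node us Var(1) step
          by (intro subtype.Var) auto
        then show ?thesis using Node us by simp
      qed
    qed
  next
    case (Super s s' t)
    have whole: "subtype \<Delta> s t"
      using Super by (blast intro: subtype.Super)
    show ?case
    proof (intro conjI ballI impI)
      fix \<tau> assume \<tau>: "\<tau> \<in> ?U" "s = subst \<theta> \<tau>" and W: "t \<in> ?W"
      show "subtype \<Delta> (subst \<theta>' \<tau>) t"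
      proof (cases \<tau>)
        case (Par x)
        then show ?thesis using whole \<tau>(2) below[OF W] by simp
      next
        case (Node \<gamma> us)
        let ?xs = "par_names \<Delta> \<gamma>"
        obtain \<rho> where \<rho>: "\<rho> \<in> set (supers \<Delta> \<gamma>)" "s' = par_subst \<rho> ?xs (map (subst \<theta>) us)"
          using Super(2) \<tau>(2) Node by (auto elim: inherits.cases)
        have us: "\<gamma> \<in> classes \<Delta>" "length us = length ?xs" "set us \<subseteq> ?U"
          using \<tau>(1) Node by (auto simp: Node_in_terms_iff rank_def par_names_def)
        have \<rho>_terms: "\<rho> \<in> terms (classes \<Delta>) (rank \<Delta>) (set ?xs)"
          using \<Delta> us(1) \<rho>(1) by (auto simp: is_class_table_def)
        \<comment> \<open>The supertype is formed before instantiation, so \<open>\<theta>\<close>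
          and \<open>\<theta>'\<close> both map it to a type inherited by their instance of
          \<open>\<tau>\<close>.\<close>
        let ?\<tau>' = "par_subst \<rho> ?xs us"
        have "?\<tau>' \<in> ?U"
          using \<rho>_terms us by (intro par_subst_in_terms)
        moreover have "s' = subst \<theta> ?\<tau>'"
          using \<rho>(2) subst_par_subst[OF \<rho>_terms us(2)] by simp
        ultimately have "subtype \<Delta> (subst \<theta>' ?\<tau>') t"
          using Super.IH W by blast
        moreover have "inherits \<Delta> (subst \<theta>' \<tau>) (subst \<theta>' ?\<tau>')"
          using inherits.intros[of \<gamma> "map (subst \<theta>') us" \<Delta> \<rho>] \<rho>(1) Node ground_subst[OF \<tau>(1)]
            subst_par_subst[OF \<rho>_terms us(2)] terms_mono[of "classes \<Delta>" "classes \<Delta>" "{}" UNIV "rank \<Delta>"]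
          by (auto simp: ground_types_def)
        ultimately show ?thesis
          using ground_subst[OF \<tau>(1)] by (blast intro: subtype.Super)
      qed
    next
      fix \<tau> assume \<tau>: "\<tau> \<in> ?U" "t = subst \<theta> \<tau>" and W: "s \<in> ?W"
      \<comment> \<open>With the closure member on the left, inheritance stays inside the closure
        and leaves \<open>\<tau>\<close> untouched.\<close>
      have "s' \<in> ?W" using W Super(2) by (rule cl.inherit)
      then show "subtype \<Delta> s (subst \<theta>' \<tau>)"
        using Super \<tau> by (blast intro: subtype.Super)
    qed
  qed
  then show "\<And>\<tau>. \<lbrakk>\<tau> \<in> ?U; s = subst \<theta> \<tau>; t \<in> ?W\<rbrakk> \<Longrightarrow> subtype \<Delta> (subst \<theta>' \<tau>) t"
    and "\<And>\<tau>. \<lbrakk>\<tau> \<in> ?U; t = subst \<theta> \<tau>; s \<in> ?W\<rbrakk> \<Longrightarrow> subtype \<Delta> s (subst \<theta>' \<tau>)"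
    by blast+
qed

section \<open>Equality of profiles as a congruence\<close>

lemma profile_subst:
  assumes \<Delta>: "is_class_table \<Delta>"
    and prof: "\<And>x. profile \<Delta> (cl \<Delta> T) (\<theta> x) = profile \<Delta> (cl \<Delta> T) (\<theta>' x)"
    and ground: "\<And>x. \<theta> x \<in> ground_types \<Delta>" "\<And>x. \<theta>' x \<in> ground_types \<Delta>"
    and \<tau>: "\<tau> \<in> terms (classes \<Delta>) (rank \<Delta>) UNIV"
  shows "profile \<Delta> (cl \<Delta> T) (subst \<theta> \<tau>) = profile \<Delta> (cl \<Delta> T) (subst \<theta>' \<tau>)"
proof -
  have "subtype \<Delta> (subst \<theta> \<tau>) w \<longleftrightarrow> subtype \<Delta> (subst \<theta>' \<tau>) w" if "w \<in> cl \<Delta> T" for w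
    using subtype_subst(1)[OF \<Delta>, of T \<theta> \<theta>', OF prof ground(2) _ \<tau> HOL.refl that]
      subtype_subst(1)[OF \<Delta>, of T \<theta>' \<theta>, OF prof[symmetric] ground(1) _ \<tau> HOL.refl that] by blast
  moreover have "subtype \<Delta> w (subst \<theta> \<tau>) \<longleftrightarrow> subtype \<Delta> w (subst \<theta>' \<tau>)" if "w \<in> cl \<Delta> T" for w
    using subtype_subst(2)[OF \<Delta>, of T \<theta> \<theta>', OF prof ground(2) _ \<tau> HOL.refl that]
      subtype_subst(2)[OF \<Delta>, of T \<theta>' \<theta>, OF prof[symmetric] ground(1) _ \<tau> HOL.refl that] by blast
  moreover have "subst \<theta> \<tau> = w \<longleftrightarrow> subst \<theta>' \<tau> = w" if "w \<in> cl \<Delta> T" for w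
    using subst_eq_in_cl[of \<theta> \<tau> \<Delta> T \<theta>', OF _ prof]
      subst_eq_in_cl[of \<theta>' \<tau> \<Delta> T \<theta>, OF _ prof[symmetric]] that by metis
  ultimately show ?thesis
    unfolding profile_def by blast
qed

lemma profile_Node_cong:
  assumes \<Delta>: "is_class_table \<Delta>"
    and ss: "Node f ss \<in> ground_types \<Delta>" and ts: "Node f ts \<in> ground_types \<Delta>"
    and eq: "map (profile \<Delta> (cl \<Delta> T)) ss = map (profile \<Delta> (cl \<Delta> T)) ts"
  shows "profile \<Delta> (cl \<Delta> T) (Node f ss) = profile \<Delta> (cl \<Delta> T) (Node f ts)"
proof -
  define n where "n = rank \<Delta> f"
  \<comment> \<open>The value beyond the rank only has to be ground and the same for
    \<open>ss\<close> and \<open>ts\<close>; \<open>Node f ss\<close> is at hand. The pattern to be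
    instantiated is \<open>f\<close> applied to the parameters \<open>0..<n\<close>.\<close>
  define \<theta> where "\<theta> us i = (if i < n then us ! i else Node f ss)" for us i
  have len: "length ss = n" "length ts = n"
    using ss ts by (auto simp: ground_types_def Node_in_terms_iff n_def)
  have pointwise: "profile \<Delta> (cl \<Delta> T) (\<theta> ss i) = profile \<Delta> (cl \<Delta> T) (\<theta> ts i)" for i
    using eq len by (auto simp: \<theta>_def list_eq_iff_nth_eq)
  have ground: "\<theta> us i \<in> ground_types \<Delta>" if "Node f us \<in> ground_types \<Delta>" for us i
    using that ss by (auto simp: \<theta>_def ground_types_def Node_in_terms_iff n_def)
  have args: "map (\<theta> us) [0..<n] = us" if "length us = n" for us
    using that by (auto simp: \<theta>_def intro: nth_equalityI)
  have "Node f (map Par [0..<n]) \<in> terms (classes \<Delta>) (rank \<Delta>) UNIV"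
    using ss by (auto simp: ground_types_def Node_in_terms_iff Par_in_terms_iff n_def)
  from profile_subst[OF \<Delta>, of T "\<theta> ss" "\<theta> ts", OF pointwise ground[OF ss] ground[OF ts] this]
  show ?thesis
    by (simp add: comp_def args len)
qed

text \<open>Non-expansiveness makes the closure of \<open>b\<close> finite, hence there are finitely
  many profiles. The second component of the profile of \<open>t\<close> contains \<open>b\<close>
  exactly if \<open>b\<close> is a subtype of \<open>t\<close>, so the language is a union of
  classes.\<close>

lemma ct_languages_subset_NRF:
  assumes "infinite (UNIV :: 'a set)" "FeatX \<notin> S"
  shows "(ct_languages S :: 'a trm set set) \<subseteq> NRF"
proof
  fix L :: "'a trm set" assume "L \<in> ct_languages S"
  then obtain \<Delta> b A where conf: "conforms S \<Delta>" and b: "b \<in> ground_types \<Delta>"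
      and A: "A \<subseteq> classes \<Delta>" and L: "L = ct_language \<Delta> b A"
    by (auto simp: ct_languages_def)
  have \<Delta>: "is_class_table \<Delta>" and "non_expansive \<Delta>"
    using conf assms(2) by (auto simp: conforms_def)
  then have fin: "finite (cl \<Delta> {b})"
    using b by (simp add: non_expansive_def)
  have ground: "ground_terms A (rank \<Delta>) \<subseteq> ground_types \<Delta>"
    unfolding ground_types_def using A by (intro terms_mono) auto
  let ?h = "profile \<Delta> (cl \<Delta> {b})"
  show "L \<in> NRF"
  proof (rule recognizable_imp_NRF[OF assms(1)])
    show "finite A"
      using A \<Delta> by (auto simp: is_class_table_def intro: finite_subset)
    have "?h ` ground_terms A (rank \<Delta>) \<subseteq> Pow (cl \<Delta> {b}) \<times> Pow (cl \<Delta> {b}) \<times> Pow (cl \<Delta> {b})"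
      by (auto simp: profile_def)
    then show "finite (?h ` ground_terms A (rank \<Delta>))"
      by (rule finite_subset) (simp add: fin)
    show "?h (Node f ss) = ?h (Node f ts)"
      if "Node f ss \<in> ground_terms A (rank \<Delta>)" "Node f ts \<in> ground_terms A (rank \<Delta>)"
        "map ?h ss = map ?h ts" for f ss ts
      using profile_Node_cong[OF \<Delta> _ _ that(3)] that(1,2) ground by blast
    show "L \<subseteq> ground_terms A (rank \<Delta>)"
      by (auto simp: L ct_language_def)
    show "t \<in> L" if "s \<in> L" "t \<in> ground_terms A (rank \<Delta>)" "?h s = ?h t" for s t
    proof -
      have "b \<in> fst (snd (?h s))"
        using that(1) by (auto simp: L ct_language_def profile_def intro: cl.base)
      then have "b \<in> fst (snd (?h t))" using that(3) by simp
      then show ?thesis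
        using that(2) by (simp add: L ct_language_def profile_def)
    qed
  qed
qed


section \<open>Regular forests are defined by covariant non-expansive class tables\<close>

definition rhs_types :: "'a grammar \<Rightarrow> 'a \<Rightarrow> 'a trm set" where
  "rhs_types G v = {Node \<sigma> (map (\<lambda>w. Node w []) vs) | \<sigma> vs. (v, \<sigma>, vs) \<in> prods G}"

text \<open>The productions of a grammar form a set but \<open>supers\<close> expects a list; the
  choice operator picks any enumeration. Forcing rank 0 off the alphabet makes variables nullary
  whatever \<open>arity\<close> says there.\<close>

definition table_of_grammar :: "'a grammar \<Rightarrow> 'a class_table" where
  "table_of_grammar G = \<lparr>classes = variables G \<union> alphabet G,
     params = (\<lambda>\<gamma>. if \<gamma> \<in> alphabet G then map (\<lambda>i. (Cov, i)) [0..<arity G \<gamma>] else []),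
     supers = (\<lambda>\<gamma>. SOME \<tau>s. set \<tau>s = rhs_types G \<gamma>)\<rparr>"

lemma par_subst_rhs:
  "par_subst (Node \<sigma> (map (\<lambda>w. Node w []) vs)) xs ts = Node \<sigma> (map (\<lambda>w. Node w []) vs)"
  by (simp add: par_subst_def)

lemma valid_variance_variable: "valid_variance \<Delta> dxs (Node v [])"
  by (rule valid_variance.Node) simp

context
  fixes G :: "'a grammar"
  assumes G: "is_grammar G"
begin

section \<open>Signature and inheritance of the table of a grammar\<close>

lemma prodD:
  assumes "(v, \<sigma>, vs) \<in> prods G"
  shows "v \<in> variables G" "v \<notin> alphabet G" "\<sigma> \<in> alphabet G" "\<sigma> \<notin> variables G"
    "length vs = arity G \<sigma>" "set vs \<subseteq> variables G"
proof -
  have disjoint: "alphabet G \<inter> variables G = {}"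
    using G by (simp add: is_grammar_def)
  have "case (v, \<sigma>, vs) of (v, \<sigma>, vs) \<Rightarrow>
      v \<in> variables G \<and> \<sigma> \<in> alphabet G \<and> length vs = arity G \<sigma> \<and> set vs \<subseteq> variables G"
    using G assms unfolding is_grammar_def by blast
  then show "v \<in> variables G" "v \<notin> alphabet G" "\<sigma> \<in> alphabet G" "\<sigma> \<notin> variables G"
    "length vs = arity G \<sigma>" "set vs \<subseteq> variables G"
    using disjoint by auto
qed

lemma finite_rhs_types: "finite (rhs_types G v)"
proof (rule finite_subset)
  show "rhs_types G v \<subseteq> (\<lambda>(v, \<sigma>, vs). Node \<sigma> (map (\<lambda>w. Node w []) vs)) ` prods G"
    by (force simp: rhs_types_def)
qed (use G in \<open>auto simp: is_grammar_def\<close>)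

lemma set_supers_table: "set (supers (table_of_grammar G) \<gamma>) = rhs_types G \<gamma>"
  using someI_ex[OF finite_list[OF finite_rhs_types[of \<gamma>]]]
  by (simp add: table_of_grammar_def)

lemma classes_table: "classes (table_of_grammar G) = variables G \<union> alphabet G"
  by (simp add: table_of_grammar_def)

lemma rank_table:
  "rank (table_of_grammar G) \<gamma> = (if \<gamma> \<in> alphabet G then arity G \<gamma> else 0)"
  by (simp add: table_of_grammar_def rank_def)

lemma var_table:
  "i < rank (table_of_grammar G) \<gamma> \<Longrightarrow> var (table_of_grammar G) \<gamma> i = Cov"
  by (auto simp: table_of_grammar_def rank_def var_def split: if_splits)

lemma variable_in_terms_table:
  "v \<in> variables G \<Longrightarrow> Node v [] \<in> terms (classes (table_of_grammar G)) (rank (table_of_grammar G)) P"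
  using G by (auto simp: Node_in_terms_iff classes_table rank_table is_grammar_def)

lemma rhs_in_terms_table:
  assumes "(v, \<sigma>, vs) \<in> prods G"
  shows "Node \<sigma> (map (\<lambda>w. Node w []) vs)
    \<in> terms (classes (table_of_grammar G)) (rank (table_of_grammar G)) P"
  using prodD[OF assms] variable_in_terms_table
  by (auto simp: Node_in_terms_iff[of \<sigma>] classes_table rank_table)

text \<open>Only variables have supertypes; they are nullary, and right-hand sides contain no
  parameters, so instantiation changes nothing.\<close>

lemma inherits_table_iff:
  "inherits (table_of_grammar G) t t' \<longleftrightarrow>
    (\<exists>v \<sigma> vs. t = Node v [] \<and> (v, \<sigma>, vs) \<in> prods G \<and> t' = Node \<sigma> (map (\<lambda>w. Node w []) vs))"
proof
  assume "inherits (table_of_grammar G) t t'"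
  then show "\<exists>v \<sigma> vs. t = Node v [] \<and> (v, \<sigma>, vs) \<in> prods G \<and> t' = Node \<sigma> (map (\<lambda>w. Node w []) vs)"
  proof cases
    case (1 \<gamma> ts \<tau>)
    then obtain \<sigma> vs where p: "(\<gamma>, \<sigma>, vs) \<in> prods G" and \<tau>: "\<tau> = Node \<sigma> (map (\<lambda>w. Node w []) vs)"
      by (auto simp: set_supers_table rhs_types_def)
    have "ts = []"
      using 1(3) prodD(2)[OF p] by (simp add: Node_in_terms_iff rank_table)
    then show ?thesis
      using 1(1,2) p \<tau> by (auto simp: par_subst_rhs)
  qed
next
  assume "\<exists>v \<sigma> vs. t = Node v [] \<and> (v, \<sigma>, vs) \<in> prods G \<and> t' = Node \<sigma> (map (\<lambda>w. Node w []) vs)"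
  then obtain v \<sigma> vs where t: "t = Node v []" "t' = Node \<sigma> (map (\<lambda>w. Node w []) vs)"
      and p: "(v, \<sigma>, vs) \<in> prods G" by blast
  from p have "Node \<sigma> (map (\<lambda>w. Node w []) vs) \<in> set (supers (table_of_grammar G) v)"
    by (auto simp: set_supers_table rhs_types_def)
  from inherits.intros[OF variable_in_terms_table[OF prodD(1)[OF p]] this] show "inherits (table_of_grammar G) t t'"
    by (simp add: t par_subst_rhs)
qed

section \<open>Conformity of the table\<close>

lemma is_class_table_table: "is_class_table (table_of_grammar G)"
  unfolding is_class_table_def
proof (intro conjI ballI allI)
  show "finite (classes (table_of_grammar G))"
    using G by (simp add: classes_table is_grammar_def)
  show "distinct (par_names (table_of_grammar G) \<gamma>)" for \<gamma>
    by (simp add: par_names_def table_of_grammar_def comp_def)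
qed (auto simp: set_supers_table rhs_types_def intro: rhs_in_terms_table)

text \<open>The first step of a chain starts at a variable and the last one ends at a
  letter.\<close>

lemma acyclic_inheritance_table: "acyclic_inheritance (table_of_grammar G)"
  unfolding acyclic_inheritance_def
proof (intro allI impI)
  fix \<gamma> \<tau>s \<gamma>' \<tau>s' assume inh: "(inherits (table_of_grammar G))\<^sup>+\<^sup>+ (Node \<gamma> \<tau>s) (Node \<gamma>' \<tau>s')"
  have "\<gamma> \<in> variables G"
    using tranclpD[OF inh] by (auto simp: inherits_table_iff dest: prodD)
  moreover have "\<gamma>' \<in> alphabet G"
    using inh by cases (auto simp: inherits_table_iff dest: prodD)
  ultimately show "\<gamma> \<noteq> \<gamma>'"
    using G by (auto simp: is_grammar_def)
qed

lemma well_formed_table: "well_formed (table_of_grammar G)"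
  unfolding well_formed_def
proof (intro conjI ballI acyclic_inheritance_table)
  fix \<gamma> \<tau> assume "\<tau> \<in> set (supers (table_of_grammar G) \<gamma>)"
  then show "valid_variance (table_of_grammar G) (params (table_of_grammar G) \<gamma>) \<tau>"
    by (auto simp: set_supers_table rhs_types_def
        intro!: valid_variance.Node[where \<tau>s = "map _ _"] valid_variance_variable)
qed

text \<open>Inheritance never builds new terms: everything reached is a subterm of \<open>T\<close>
  or of one of the finitely many right-hand sides.\<close>

lemma non_expansive_table: "non_expansive (table_of_grammar G)"
  unfolding non_expansive_def
proof (intro allI impI)
  fix T assume "T \<subseteq> ground_types (table_of_grammar G) \<and> finite T"
  then have "finite (\<Union> (subterms ` (T \<union> (\<Union>v\<in>variables G. rhs_types G v))))"
    using G finite_rhs_types by (auto simp: is_grammar_def)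
  moreover have "t \<in> \<Union> (subterms ` (T \<union> (\<Union>v\<in>variables G. rhs_types G v)))"
    if "t \<in> cl (table_of_grammar G) T" for t
    using that
  proof induction
    case (base t)
    then show ?case by (meson UN_I UnI1 subterms_refl)
  next
    case (decomp \<gamma> ts t)
    then show ?case by (meson UN_E UN_I arg_in_subterms)
  next
    case (inherit t t')
    then have "t' \<in> (\<Union>v\<in>variables G. rhs_types G v)"
      by (auto simp: inherits_table_iff rhs_types_def dest: prodD)
    then show ?case by (meson UN_I UnI2 subterms_refl)
  qed
  ultimately show "finite (cl (table_of_grammar G) T)"
    by (meson finite_subset subsetI)
qed

text \<open>\<open>FeatM\<close> is present because a variable may have several productions with the
  same letter, that is, several instantiations of one class.\<close>

lemma conforms_table: "conforms {FeatM} (table_of_grammar G)"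
  by (simp add: conforms_def is_class_table_table well_formed_table non_expansive_table
      contravariance_free_def var_table)

section \<open>Subtyping in the table as derivation in the grammar\<close>

lemma subtype_table_iff:
  assumes "t \<in> ground_terms (alphabet G) (arity G)" "v \<in> variables G"
  shows "subtype (table_of_grammar G) (Node v []) t \<longleftrightarrow> (derives G)\<^sup>*\<^sup>* (Node v []) t"
  using assms
proof (induction t arbitrary: v rule: trm.induct)
  case (Node f ts)
  let ?\<Delta> = "table_of_grammar G"
  have f: "f \<in> alphabet G" "f \<notin> variables G" "length ts = arity G f"
    using Node.prems(1) G by (auto simp: Node_in_terms_iff is_grammar_def)
  have ground: "Node f ts \<in> ground_types ?\<Delta>"
  proof -
    have "ground_terms (alphabet G) (arity G) = ground_terms (alphabet G) (rank ?\<Delta>)"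
      by (intro terms_cong) (simp add: rank_table)
    also have "\<dots> \<subseteq> ground_types ?\<Delta>"
      unfolding ground_types_def by (intro terms_mono) (auto simp: classes_table)
    finally show ?thesis using Node.prems(1) by blast
  qed
  \<comment> \<open>Letters have no supertypes, so types rooted at a letter are compared by
    \<open>Var\<close> alone, and covariance reduces this to the arguments.\<close>
  have cov: "subtype ?\<Delta> (Node \<sigma> (map (\<lambda>w. Node w []) vs)) (Node f ts) \<longleftrightarrow>
      \<sigma> = f \<and> list_all2 (\<lambda>w. subtype ?\<Delta> (Node w [])) vs ts" (is "?L \<longleftrightarrow> ?R")
    if p: "(v, \<sigma>, vs) \<in> prods G" for \<sigma> vs
  proof
    assume ?L
    then show ?R
    proof cases
      case Var
      then show ?thesis
        using prodD[OF p] f var_table[of _ f]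
        by (auto simp: list_all2_conv_all_nth rank_table)
    next
      case (Super t')
      then show ?thesis
        using prodD[OF p] by (auto simp: inherits_table_iff dest: prodD)
    qed
  next
    assume R: ?R
    then have "Node f (map (\<lambda>w. Node w []) vs) \<in> ground_types ?\<Delta>"
      using rhs_in_terms_table[OF p] by (auto simp: ground_types_def)
    moreover have "subtype ?\<Delta> (map (\<lambda>w. Node w []) vs ! i) (ts ! i)" if "i < rank ?\<Delta> f" for i
      using R that f by (auto simp: list_all2_conv_all_nth rank_table)
    ultimately show ?L
      using R ground var_table[of _ f] by (auto intro!: subtype.Var)
  qed
  \<comment> \<open>The variable \<open>v\<close> differs from the letter \<open>f\<close>, so the
    derivation must begin with \<open>Super\<close>, which selects a production. The result is the
    recursion known for derivations.\<close>
  have "subtype ?\<Delta> (Node v []) (Node f ts) \<longleftrightarrow>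
      (\<exists>\<sigma> vs. (v, \<sigma>, vs) \<in> prods G \<and> subtype ?\<Delta> (Node \<sigma> (map (\<lambda>w. Node w []) vs)) (Node f ts))"
    using Node.prems(2) f(2) variable_in_terms_table[of v "{}"]
    by (subst subtype.simps) (auto simp: inherits_table_iff ground_types_def)
  also have "\<dots> \<longleftrightarrow> (\<exists>vs. (v, f, vs) \<in> prods G \<and> list_all2 (\<lambda>w. subtype ?\<Delta> (Node w [])) vs ts)"
    using cov by blast
  also have "\<dots> \<longleftrightarrow> (\<exists>vs. (v, f, vs) \<in> prods G \<and>
      list_all2 (\<lambda>w. (derives G)\<^sup>*\<^sup>* (Node w [])) vs ts)"
  proof -
    have "list_all2 (\<lambda>w. subtype ?\<Delta> (Node w [])) vs ts \<longleftrightarrow>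
        list_all2 (\<lambda>w. (derives G)\<^sup>*\<^sup>* (Node w [])) vs ts" if "(v, f, vs) \<in> prods G" for vs
      using prodD(6)[OF that] Node
      by (intro list.rel_cong HOL.refl) (auto simp: Node_in_terms_iff)
    then show ?thesis by blast
  qed
  also have "\<dots> \<longleftrightarrow> (derives G)\<^sup>*\<^sup>* (Node v []) (Node f ts)"
    using derives_star_Node_iff[OF G Node.prems(2,1)] by simp
  finally show ?case .
qed (simp add: Par_in_terms_iff)

lemma ct_language_table:
  "ct_language (table_of_grammar G) (Node (start G) []) (alphabet G) = grammar_language G"
proof -
  have "ground_terms (alphabet G) (rank (table_of_grammar G)) = ground_terms (alphabet G) (arity G)"
    by (intro terms_cong) (simp add: rank_table)
  moreover have "start G \<in> variables G"
    using G by (simp add: is_grammar_def)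
  ultimately show ?thesis
    by (auto simp: ct_language_def grammar_language_def subtype_table_iff)
qed

end

lemma NRF_subset_ct_languages: "NRF \<subseteq> ct_languages {FeatM}"
proof
  fix L :: "'a trm set" assume "L \<in> NRF"
  then obtain G where G: "is_grammar G" and L: "L = grammar_language G"
    by (auto simp: NRF_def)
  have "Node (start G) [] \<in> ground_types (table_of_grammar G)"
    using variable_in_terms_table[OF G] G by (simp add: ground_types_def is_grammar_def)
  moreover have "alphabet G \<subseteq> classes (table_of_grammar G)"
    by (simp add: classes_table[OF G])
  ultimately show "L \<in> ct_languages {FeatM}"
    using ct_language_table[OF G] conforms_table[OF G] L
    unfolding ct_languages_def by blast
qed

text \<open>A larger set of features imposes fewer conditions on tables.\<close>

lemma ct_languages_mono: "S \<subseteq> S' \<Longrightarrow> ct_languages S \<subseteq> ct_languages S'"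
  unfolding ct_languages_def conforms_def by blast

theorem corollary5p3:
  assumes "infinite (UNIV :: 'a set)"
  shows "(ct_languages {FeatM} :: 'a trm set set) = ct_languages {FeatC, FeatM}
       \<and> (ct_languages {FeatC, FeatM} :: 'a trm set set) = NRF"
proof -
  have "(ct_languages {FeatM} :: 'a trm set set) \<subseteq> ct_languages {FeatC, FeatM}"
    by (rule ct_languages_mono) simp
  moreover have "(ct_languages {FeatC, FeatM} :: 'a trm set set) \<subseteq> NRF"
    using assms by (rule ct_languages_subset_NRF) simp
  ultimately show ?thesis
    using NRF_subset_ct_languages[where 'a = 'a] by blast
qed

end
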